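(* Let $N\ge 2$, let $A\in\mathbb{R}^{n\times n}$, $B\in\mathbb{R}^{n\times 1}$, $C\in\mathbb{R}^{n\times l}$, and let $g\in\mathbb{R}^l$ be such that $g^{\mathrm T}C^{\mathrm T}(sI_n-A)^{-1}B$ is hyper-minimum-phase with $\varkappa_0>0$. Let $L$ be the Laplace matrix of a unit weighted digraph on $N$ vertices, without self-loops, having at least one directed spanning tree. Let $0<\varepsilon\le 1/\sqrt N$, and let $\mathcal S_\varepsilon$ and $\mathcal K_r$ be the sets defined in the context. For $k'=(k_1',\dots,k_N')\in\mathcal S_\varepsilon$ put $K'=\mathrm{diag}(k_1',\dots,k_N')$ and $$h(k')=\frac{\varkappa_0}{r(K'L)}\cdot k',\qquad h_\rho(k')=\|h(k')\|_2 .$$ Then $h(\mathcal S_\varepsilon)\subset\partial\mathcal K_r$ and the map $h:\mathcal S_\varepsilon\to h(\mathcal S_\varepsilon)\subset\partial\mathcal K_r$ is continuous. The map $h_\rho:\mathcal S_\varepsilon\to\mathbb{R}$ is continuous and has (attains) a minimum and a maximum.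
   Context: Digraph conventions: a digraph is $\mathcal G=(\mathcal V,\mathcal E)$ with $\mathcal E\subseteq\mathcal V\times\mathcal V$ and no self-loops. In an arc $(\alpha,\beta)$ the vertex $\beta$ is called the parent of $\alpha$. A directed tree is a digraph in which all vertices except one (the root) have exactly one parent; a directed spanning tree of $\mathcal G$ is a directed tree formed by all vertices of $\mathcal G$ and some of its arcs such that there is a directed path (following arcs $(\alpha,\beta)$ from $\alpha$ to $\beta$) from every vertex to the root. Unit weighted: the adjacency matrix $\mathcal A(\mathcal G)$ has $(i,j)$ entry $1$ if $(i,j)\in\mathcal E$ and $0$ otherwise. The Laplace matrix is $L=\mathrm{diag}(\mathcal A(\mathcal G)\mathbf 1_N)-\mathcal A(\mathcal G)$, with $\mathbf 1_N$ the all-ones vector. For a diagonal matrix $K'$ with positive diagonal, $K'L$ is the Laplace matrix of the same digraph with positive arc weights; $0$ is a simple eigenvalue of it and all other eigenvalues have positive real part. $r(K'L)=\min_{\lambda\ne0}\mathrm{Re}\,\lambda$ over the nonzero eigenvalues $\lambda$ of $K'L$. Hyper-minimum-phase: with $\chi(s)=C^{\mathrm T}(sI_n-A)^{-1}B$, the function $g^{\mathrm T}\chi(s)$ is hyper-minimum-phase if its numerator (with respect to the denominator $\det(sI_n-A)$) is a Hurwitz polynomial of degree $n-1$ with positive coefficients. The number $\varkappa_0$ is $$\varkappa_0=\sup_{\omega\in\mathbb{R}}\mathrm{Re}\left(-\big(g^{\mathrm T}\chi(\mathfrak i\omega)\big)^{-1}\right),$$ where $(g^{\mathrm T}\chi)^{-1}$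 is the reciprocal rational function, evaluated at $\mathfrak i\omega$. Sets: $\mathcal O=\{(k_1,\dots,k_N)\in\mathbb{R}^N : k_i>0,\ i=1,\dots,N\}$; $\mathcal S$ is the unit sphere $\{\hat k'\in\mathbb{R}^N:\sum_{i=1}^N(k_i')^2=1\}$; $$\mathcal S_\varepsilon=\{\hat k'\in\mathcal S : k_i'\ge\varepsilon,\ i=1,\dots,N\};$$ $$\mathcal K_r=\left\{\hat k\in\mathcal O : \hat k=k\cdot\hat k',\ \hat k'\in\mathcal S,\ k>0,\ k>\frac{\varkappa_0}{r(K'L)}\right\},\quad K'=\mathrm{diag}(k_1',\dots,k_N').$$ $\partial\mathcal K_r$ is the topological boundary of $\mathcal K_r$ in $\mathbb{R}^N$, and $\|\cdot\|_2$ is the Euclidean norm. *)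

theory Defs
  imports "HOL-Analysis.Analysis" "HOL-Computational_Algebra.Computational_Algebra"
    "HOL-Computational_Algebra.Field_as_Ring"
begin

text \<open>Digraphs have vertex set \<^term>\<open>UNIV :: 'N set\<close>; for an arc \<open>(a, b)\<close> the vertex
  \<open>b\<close> is the parent of \<open>a\<close>.\<close>

definition no_self_loops :: "('N \<times> 'N) set \<Rightarrow> bool" where
  "no_self_loops E \<longleftrightarrow> (\<forall>v. (v, v) \<notin> E)"

definition directed_spanning_tree :: "('N \<times> 'N) set \<Rightarrow> ('N \<times> 'N) set \<Rightarrow> bool" where
  "directed_spanning_tree E T \<longleftrightarrow> T \<subseteq> E \<and>
     (\<exists>root. (\<forall>v. v \<noteq> root \<longrightarrow> (\<exists>!p. (v, p) \<in> T)) \<and> (\<forall>p. (root, p) \<notin> T) \<and>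
             (\<forall>v. (v, root) \<in> T\<^sup>*))"

definition diag :: "real ^ 'N \<Rightarrow> real ^ 'N ^ 'N" where
  "diag k = (\<chi> i j. if i = j then k $ i else 0)"

definition adjacency_matrix :: "('N \<times> 'N) set \<Rightarrow> real ^ 'N ^ 'N" where
  "adjacency_matrix E = (\<chi> i j. if (i, j) \<in> E then 1 else 0)"

definition laplace_matrix :: "('N \<times> 'N) set \<Rightarrow> real ^ 'N ^ 'N" where
  "laplace_matrix E = diag (adjacency_matrix E *v vec 1) - adjacency_matrix E"

definition complex_eigenvalue :: "real ^ 'N ^ 'N \<Rightarrow> complex \<Rightarrow> bool" where
  "complex_eigenvalue M z \<longleftrightarrow>
     (\<exists>v :: complex ^ 'N. v \<noteq> 0 \<and> map_matrix complex_of_real M *v v = z *s v)"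

definition min_re_eigenvalue :: "real ^ 'N ^ 'N \<Rightarrow> real" where
  "min_re_eigenvalue M = Min (Re ` {z. complex_eigenvalue M z \<and> z \<noteq> 0})"

text \<open>Rational functions in \<open>s\<close> are elements of the field of fractions
  \<^typ>\<open>real poly fract\<close>, so that \<open>(sI - A)\<inverse>\<close> is a genuine inverse over this field.\<close>

definition rat_const :: "real \<Rightarrow> real poly fract" where
  "rat_const a = Fract [:a:] 1"

definition rat_var :: "real poly fract" where
  "rat_var = Fract [:0, 1:] 1"

definition transfer_function ::
  "real ^ 'n ^ 'n \<Rightarrow> real ^ 1 ^ 'n \<Rightarrow> real ^ 'l ^ 'n \<Rightarrow> (real poly fract) ^ 1 ^ 'l" where
  "transfer_function A B C =
     transpose (map_matrix rat_const C) **
     matrix_inv (mat rat_var - map_matrix rat_const A) ** map_matrix rat_const B"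

definition scalar_transfer_function ::
  "real ^ 'n ^ 'n \<Rightarrow> real ^ 1 ^ 'n \<Rightarrow> real ^ 'l ^ 'n \<Rightarrow> real ^ 'l \<Rightarrow> real poly fract" where
  "scalar_transfer_function A B C g =
     (\<Sum>i\<in>UNIV. rat_const (g $ i) * transfer_function A B C $ i $ 1)"

definition characteristic_poly :: "real ^ 'n ^ 'n \<Rightarrow> real poly" where
  "characteristic_poly A = det (mat [:0, 1:] - map_matrix (\<lambda>a. [:a:]) A)"

definition hurwitz_poly :: "real poly \<Rightarrow> bool" where
  "hurwitz_poly p \<longleftrightarrow> (\<forall>z. poly (map_poly complex_of_real p) z = 0 \<longrightarrow> Re z < 0)"

text \<open>The numerator is taken with respect to the denominator \<open>det (sI - A)\<close>, without
  cancelling common factors; it is unique because this denominator is nonzero.\<close>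

definition hyper_minimum_phase ::
  "real ^ 'n ^ 'n \<Rightarrow> real ^ 1 ^ 'n \<Rightarrow> real ^ 'l ^ 'n \<Rightarrow> real ^ 'l \<Rightarrow> bool" where
  "hyper_minimum_phase A B C g \<longleftrightarrow>
     (\<exists>p. scalar_transfer_function A B C g = Fract p (characteristic_poly A) \<and>
          hurwitz_poly p \<and> degree p = CARD('n) - 1 \<and> (\<forall>i\<le>degree p. coeff p i > 0))"

text \<open>Evaluation uses the representation in lowest terms; at a pole it yields \<open>0\<close>.\<close>

definition eval_rat :: "real poly fract \<Rightarrow> complex \<Rightarrow> complex" where
  "eval_rat f z =
     poly (map_poly complex_of_real (fst (quot_of_fract f))) z /
     poly (map_poly complex_of_real (snd (quot_of_fract f))) z"

text \<open>For a hyper-minimum-phase function the reciprocal has no poles on the imaginary axis, and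
  the set of values below is bounded, because the degrees of \<open>det (sI - A)\<close> and of the numerator
  differ by \<open>1\<close> and both leading coefficients are real; hence the real supremum is the
  intended one.\<close>

definition kappa0 ::
  "real ^ 'n ^ 'n \<Rightarrow> real ^ 1 ^ 'n \<Rightarrow> real ^ 'l ^ 'n \<Rightarrow> real ^ 'l \<Rightarrow> real" where
  "kappa0 A B C g =
     (SUP \<omega>::real. Re (- eval_rat (inverse (scalar_transfer_function A B C g))
                           (\<i> * complex_of_real \<omega>)))"

definition positive_orthant :: "(real ^ 'N) set" where
  "positive_orthant = {k. \<forall>i. k $ i > 0}"

definition S_eps :: "real \<Rightarrow> (real ^ 'N) set" where
  "S_eps \<epsilon> = {k \<in> sphere 0 1. \<forall>i. k $ i \<ge> \<epsilon>}"

definition K_r :: "real \<Rightarrow> real ^ 'N ^ 'N \<Rightarrow> (real ^ 'N) set" where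
  "K_r \<kappa> L = {v \<in> positive_orthant. \<exists>k k'. v = k *\<^sub>R k' \<and> k' \<in> sphere 0 1 \<and> k > 0 \<and>
                k > \<kappa> / min_re_eigenvalue (diag k' ** L)}"

end

theory Submission
  imports Defs
begin

text \<open>The point is that \<open>r(K'L)\<close> is positive and
  depends continuously on the positive weights. Since \<open>L\<close> annihilates the all-ones vector,
  the characteristic polynomial of \<open>K'L\<close> is \<open>s\<close> times a monic polynomial \<open>q\<close> of degree \<open>N - 1\<close>
  with coefficients continuous in \<open>k'\<close>. By the maximum principle along the spanning tree the kernel
  of \<open>K'L\<close> consists of the constant vectors and its range contains no other constant vector than
  \<open>0\<close>; hence \<open>q(0) \<noteq> 0\<close>, and the roots of \<open>q\<close> are exactly the nonzero eigenvalues. By Gershgorin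
  these are uniformly bounded with positive real part, so uniform continuity of \<open>q\<close> on a compact set
  makes the least real part of its roots continuous.\<close>

section \<open>Roots of monic complex polynomials\<close>

text \<open>\<open>p\<close> is a product of \<open>degree p\<close> factors \<open>z - w\<close>,
  each of modulus at least \<open>d\<close>. Contrapositively, a small value at \<open>z\<close>
  forces a root close to \<open>z\<close>.\<close>

lemma monic_poly_norm_ge:
  fixes p :: "complex poly"
  assumes "lead_coeff p = 1" and "\<And>w. poly p w = 0 \<Longrightarrow> d \<le> dist z w" and "0 \<le> d"
  shows "d ^ degree p \<le> norm (poly p z)"
  using assms
proof (induction "degree p" arbitrary: p)
  case 0
  then have "p = 1"
    by (metis degree_0_id of_nat_1 one_pCons lead_coeff_pCons(2) pCons_one)
  then show ?case by simp
next
  case (Suc n)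
  then obtain w where w: "poly p w = 0"
    using alg_closed_imp_poly_has_root[of p] by auto
  then obtain q where q: "p = [:-w, 1:] * q"
    by (metis poly_eq_0_iff_dvd dvdE)
  have lead: "lead_coeff q = 1"
    using Suc.prems(1) unfolding q lead_coeff_mult by simp
  then have "q \<noteq> 0" by auto
  then have deg: "degree p = Suc (degree q)"
    unfolding q by (subst degree_mult_eq) auto
  have "d ^ degree q \<le> norm (poly q z)"
    using Suc deg lead q by (intro Suc.hyps(1)) auto
  moreover have "d \<le> norm (z - w)"
    using Suc.prems(2)[OF w] by (simp add: dist_norm)
  ultimately have "d * d ^ degree q \<le> norm (z - w) * norm (poly q z)"
    using \<open>0 \<le> d\<close> by (intro mult_mono) auto
  then show ?case
    unfolding deg by (subst q) (simp add: norm_mult[symmetric] algebra_simps)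
qed

definition min_re_root :: "complex poly \<Rightarrow> real" where
  "min_re_root p = Min (Re ` {z. poly p z = 0})"

lemma min_re_root_le:
  assumes "p \<noteq> 0" "poly p z = 0"
  shows "min_re_root p \<le> Re z"
  unfolding min_re_root_def using assms poly_roots_finite[of p] by (intro Min_le) auto

lemma min_re_root_attained:
  assumes "degree p > 0"
  obtains z where "poly p z = 0" "min_re_root p = Re z"
proof -
  have "finite (Re ` {z. poly p z = 0})"
    using assms by (intro finite_imageI poly_roots_finite) auto
  moreover have "Re ` {z. poly p z = 0} \<noteq> {}"
    using alg_closed_imp_poly_has_root[OF assms] by auto
  ultimately have "min_re_root p \<in> Re ` {z. poly p z = 0}"
    unfolding min_re_root_def by (rule Min_in)
  then show ?thesis using that by auto
qed

text \<open>If \<open>w\<close> is a root of \<open>Q y\<close>, then \<open>poly (Q x) w\<close> is close to \<open>0\<close>, so the monic polynomial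
  \<open>Q x\<close> has a root near \<open>w\<close>. Uniform continuity makes this symmetric in \<open>x\<close> and \<open>y\<close>.\<close>
lemma continuous_on_min_re_root:
  fixes Q :: "'a::metric_space \<Rightarrow> complex poly"
  assumes S: "compact S"
    and cont: "continuous_on (S \<times> UNIV) (\<lambda>(x, z). poly (Q x) z)"
    and monic: "\<And>x. x \<in> S \<Longrightarrow> lead_coeff (Q x) = 1"
    and deg: "\<And>x. x \<in> S \<Longrightarrow> degree (Q x) = m" and m: "m > 0"
    and bound: "\<And>x z. x \<in> S \<Longrightarrow> poly (Q x) z = 0 \<Longrightarrow> norm z \<le> R"
  shows "continuous_on S (\<lambda>x. min_re_root (Q x))"
proof -
  \<comment> \<open>All roots lie in \<open>cball 0 R\<close>, so it suffices to let
    \<open>z\<close> range over this ball, which makes the domain compact.\<close>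
  have "uniformly_continuous_on (S \<times> cball 0 R) (\<lambda>(x, z). poly (Q x) z)"
    using S by (intro compact_uniformly_continuous continuous_on_subset[OF cont] compact_Times) auto
  note uc = this[unfolded uniformly_continuous_on_def, rule_format]
  have "\<exists>d>0. \<forall>y\<in>S. dist y x < d \<longrightarrow> dist (min_re_root (Q y)) (min_re_root (Q x)) < e"
    if "x \<in> S" "e > 0" for x e
  proof -
    \<comment> \<open>The tolerance \<open>e ^ m\<close> matches the root bound: a monic polynomial
      of degree \<open>m\<close> with modulus below \<open>e ^ m\<close> at \<open>w\<close> has a
      root within \<open>e\<close> of \<open>w\<close>.\<close>
    obtain d where d: "d > 0"
      and close: "\<And>u v. u \<in> S \<times> cball 0 R \<Longrightarrow> v \<in> S \<times> cball 0 R \<Longrightarrow> dist v u < d \<Longrightarrow>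
        dist (case v of (x, z) \<Rightarrow> poly (Q x) z) (case u of (x, z) \<Rightarrow> poly (Q x) z) < e ^ m"
      using uc[of "e ^ m"] \<open>e > 0\<close> by auto
    have below: "min_re_root (Q a) < min_re_root (Q b) + e"
      if ab: "a \<in> S" "b \<in> S" "dist a b < d" for a b
    proof -
      obtain w where w: "poly (Q b) w = 0" "min_re_root (Q b) = Re w"
        using min_re_root_attained[of "Q b"] deg[OF ab(2)] m by metis
      have "norm w \<le> R" using bound w ab by blast
      then have "norm (poly (Q a) w) < e ^ m"
        using close[of "(b, w)" "(a, w)"] ab w by (simp add: dist_Pair_Pair)
      then obtain v where v: "poly (Q a) v = 0" "dist w v < e"
        using monic_poly_norm_ge[OF monic[OF ab(1)], of e w] deg[OF ab(1)] \<open>e > 0\<close>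
        by force
      have "Q a \<noteq> 0" using deg[OF ab(1)] m by auto
      then have "min_re_root (Q a) \<le> Re v"
        using v(1) by (rule min_re_root_le)
      also have "Re v - Re w \<le> dist w v"
        by (metis complex_Re_le_cmod dist_commute dist_norm minus_complex.simps(1))
      then have "Re v < Re w + e" using v(2) by linarith
      finally show ?thesis using w(2) by simp
    qed
    show ?thesis
      using d below \<open>x \<in> S\<close> by (intro exI[of _ d]) (force simp: dist_real_def dist_commute abs_less_iff)
  qed
  then show ?thesis unfolding continuous_on_iff by blast
qed

section \<open>Characteristic polynomials\<close>

lemma poly_det: "poly (det A) z = det (map_matrix (\<lambda>p. poly p z) A)"
  for A :: "'a::comm_ring_1 poly ^ 'n ^ 'n"
  by (simp add: det_def poly_sum poly_prod)

text \<open>Stated for the coefficient at \<open>card S\<close> instead of the leading one, since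
  constant factors, such as off-diagonal entries in the Leibniz formula, lower the degree.\<close>

lemma degree_coeff_prod:
  fixes f :: "'b \<Rightarrow> 'a::comm_ring_1 poly"
  assumes "finite S" "\<And>i. i \<in> S \<Longrightarrow> degree (f i) \<le> 1"
  shows "degree (prod f S) \<le> card S \<and> coeff (prod f S) (card S) = (\<Prod>i\<in>S. coeff (f i) 1)"
  using assms
proof (induction S rule: finite_induct)
  case (insert x S)
  let ?q = "prod f S"
  have q: "degree ?q \<le> card S" "coeff ?q (card S) = (\<Prod>i\<in>S. coeff (f i) 1)"
    using insert by auto
  have f: "degree (f x) \<le> 1" using insert by auto
  then have fx: "f x = [:coeff (f x) 0, coeff (f x) 1:]"
    by (intro poly_eqI) (auto simp: coeff_pCons coeff_eq_0 split: nat.split)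
  have prod: "prod f (insert x S) = smult (coeff (f x) 0) ?q + pCons 0 (smult (coeff (f x) 1) ?q)"
    using insert.hyps by (subst prod.insert, simp, simp, subst fx) simp
  have "degree (prod f (insert x S)) \<le> Suc (card S)"
    unfolding prod using q(1)
    by (intro degree_add_le order_trans[OF degree_pCons_le])
      (auto intro: order_trans[OF degree_smult_le])
  moreover have "coeff ?q (Suc (card S)) = 0"
    using q(1) by (simp add: coeff_eq_0)
  ultimately show ?case
    using insert.hyps q(2) by (simp add: prod)
qed auto

lemma degree_coeff_det:
  fixes A :: "'a::comm_ring_1 poly ^ 'n ^ 'n"
  assumes "\<And>i j. degree (A $ i $ j) \<le> 1"
  shows "degree (det A) \<le> CARD('n)"
    and "coeff (det A) CARD('n) = det (map_matrix (\<lambda>p. coeff p 1) A)"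
proof -
  note pr = degree_coeff_prod[OF finite_class.finite_UNIV, of "\<lambda>i. A $ i $ \<sigma> i" for \<sigma>, OF assms]
  have of_int: "(of_int k :: 'a poly) = [:of_int k:]" for k
    by (simp add: of_int_poly)
  show "degree (det A) \<le> CARD('n)"
    unfolding det_def using pr
    by (intro degree_sum_le) (auto simp: of_int intro: order_trans[OF degree_smult_le])
  show "coeff (det A) CARD('n) = det (map_matrix (\<lambda>p. coeff p 1) A)"
    unfolding det_def using pr by (simp add: coeff_sum of_int)
qed

definition char_matrix :: "complex ^ 'n ^ 'n \<Rightarrow> complex poly ^ 'n ^ 'n" where
  "char_matrix M = mat [:0, 1:] - map_matrix (\<lambda>a. [:a:]) M"

lemma poly_det_char_matrix: "poly (det (char_matrix M)) z = det (mat z - M)"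
  unfolding poly_det char_matrix_def
  by (intro arg_cong[of _ _ det]) (simp add: vec_eq_iff mat_def)

text \<open>The linear coefficients of \<open>char_matrix M\<close> form the identity matrix, so the
  top coefficient is its determinant.\<close>

lemma monic_det_char_matrix:
  fixes M :: "complex ^ 'n ^ 'n"
  shows "degree (det (char_matrix M)) = CARD('n)" and "lead_coeff (det (char_matrix M)) = 1"
proof -
  have deg: "degree (char_matrix M $ i $ j) \<le> 1" for i j
    by (simp add: char_matrix_def mat_def)
  have "map_matrix (\<lambda>p. coeff p 1) (char_matrix M) = mat 1"
    by (simp add: char_matrix_def vec_eq_iff mat_def)
  then have "coeff (det (char_matrix M)) CARD('n) = 1"
    using degree_coeff_det(2)[of "char_matrix M", OF deg] by simp
  then show "degree (det (char_matrix M)) = CARD('n)" "lead_coeff (det (char_matrix M)) = 1"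
    using degree_coeff_det(1)[of "char_matrix M", OF deg]
    by (metis le_degree le_antisym zero_neq_one)+
qed

lemma det_eq_0_iff_kernel: "det A = 0 \<longleftrightarrow> (\<exists>x. x \<noteq> 0 \<and> A *v x = 0)"
  for A :: "'a::field ^ 'n ^ 'n"
  using invertible_det_nz[of A] matrix_left_invertible_ker[of A] invertible_left_inverse[of A]
  by blast

text \<open>If \<open>M\<close> has zero row sums, adding all other columns of \<open>sI - M\<close>
  to column \<open>k\<close> turns that column into \<open>s\<close> throughout; pulling out
  \<open>s\<close> leaves this matrix.\<close>

definition ones_column :: "'n \<Rightarrow> 'a::one ^ 'n ^ 'n \<Rightarrow> 'a ^ 'n ^ 'n" where
  "ones_column k A = (\<chi> i j. if j = k then 1 else A $ i $ j)"

text \<open>By Cramer's rule both sides are the determinant of \<open>A\<close> with all entries of column \<open>k\<close>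
  replaced by \<open>z\<close>.\<close>
lemma det_ones_column:
  fixes A :: "'a::field ^ 'n ^ 'n"
  assumes "A *v 1 = vec z"
  shows "det A = z * det (ones_column k A)"
proof -
  let ?R = "ones_column k A"
  let ?D = "(\<chi> i j. if j = k then z else A $ i $ j) :: 'a ^ 'n ^ 'n"
  have "?D = (\<chi> i j. if j = k then (A *v 1) $ i else A $ i $ j)"
    unfolding assms vec_component ..
  then have "det ?D = det A"
    by (simp add: cramer_lemma)
  \<comment> \<open>Column \<open>k\<close> of \<open>?R\<close> consists of ones, so
    \<open>?R\<close> maps \<open>axis k z\<close> to \<open>vec z\<close>, and Cramer's rule yields
    the factor \<open>z\<close>.\<close>
  moreover have "?D = (\<chi> i j. if j = k then (?R *v axis k z) $ i else ?R $ i $ j)"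
    by (simp add: vec_eq_iff ones_column_def matrix_vector_mult_def axis_def if_distrib cong: if_cong)
  then have "det ?D = z * det ?R"
    by (simp add: cramer_lemma axis_def)
  ultimately show ?thesis by simp
qed

text \<open>For a matrix with vanishing row sums this is the characteristic polynomial divided by the
  indeterminate.\<close>
definition reduced_char_poly :: "'n \<Rightarrow> complex ^ 'n ^ 'n \<Rightarrow> complex poly" where
  "reduced_char_poly k M = det (ones_column k (char_matrix M))"

lemma poly_reduced_char_poly: "poly (reduced_char_poly k M) z = det (ones_column k (mat z - M))"
  unfolding reduced_char_poly_def poly_det char_matrix_def
  by (intro arg_cong[of _ _ det]) (simp add: vec_eq_iff mat_def ones_column_def)

lemma det_eq_mult_reduced_char_poly:
  assumes "M *v 1 = 0"
  shows "det (mat z - M) = z * poly (reduced_char_poly k M) z"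
proof -
  have "(mat z - M) *v 1 = vec z"
    using assms
    by (simp add: matrix_vector_mult_diff_rdistrib)
       (simp add: vec_eq_iff matrix_vector_mult_def mat_def)
  then show ?thesis
    by (simp add: det_ones_column poly_reduced_char_poly)
qed

lemma monic_reduced_char_poly:
  fixes M :: "complex ^ 'n ^ 'n"
  assumes "M *v 1 = 0"
  shows "degree (reduced_char_poly k M) = CARD('n) - 1"
    and "lead_coeff (reduced_char_poly k M) = 1"
proof -
  let ?q = "reduced_char_poly k M"
  \<comment> \<open>Polynomials over the infinite field of complex numbers are equal once their
    values agree.\<close>
  have eq: "det (char_matrix M) = [:0, 1:] * ?q"
    by (intro poly_eq_poly_eq_iff[THEN iffD1] ext)
      (simp add: poly_det_char_matrix det_eq_mult_reduced_char_poly[OF assms, of _ k])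
  have "lead_coeff ([:0, 1:] * ?q) = 1"
    using monic_det_char_matrix(2)[of M] by (simp only: eq)
  then show lead: "lead_coeff ?q = 1"
    by (simp only: lead_coeff_mult) simp
  then have "?q \<noteq> 0" by auto
  then have "degree ([:0, 1:] * ?q) = Suc (degree ?q)"
    by (subst degree_mult_eq) auto
  then show "degree ?q = CARD('n) - 1"
    using monic_det_char_matrix(1)[of M] by (simp only: eq)
qed

lemma continuous_on_det:
  fixes A :: "'a::topological_space \<Rightarrow> 'b::real_normed_field ^ 'n ^ 'n"
  assumes "\<And>i j. continuous_on S (\<lambda>x. A x $ i $ j)"
  shows "continuous_on S (\<lambda>x. det (A x))"
  unfolding det_def by (intro continuous_intros assms)

section \<open>Weighted Laplace matrices\<close>

abbreviation complex_laplace :: "('N::finite \<times> 'N) set \<Rightarrow> real ^ 'N \<Rightarrow> complex ^ 'N ^ 'N" where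
  "complex_laplace E k \<equiv> map_matrix complex_of_real (diag k ** laplace_matrix E)"

lemma complex_laplace_nth:
  "complex_laplace E k $ i $ j = complex_of_real (k $ i * laplace_matrix E $ i $ j)"
  by (simp add: diag_def matrix_matrix_mult_def if_distrib[of "\<lambda>x. x * _"] cong: if_cong)

text \<open>Row sums vanish, so the matrix acts through differences along arcs; both Gershgorin's
  estimate and the maximum principle start from this form.\<close>

lemma complex_laplace_mult:
  "(complex_laplace E k *v v) $ i = complex_of_real (k $ i) * (\<Sum>j | (i, j) \<in> E. v $ i - v $ j)"
proof -
  let ?a = "\<lambda>j. if (i, j) \<in> E then 1 else 0 :: complex"
  have entry: "complex_of_real (laplace_matrix E $ i $ j) =
      (if i = j then \<Sum>j\<in>UNIV. ?a j else 0) - ?a j" for j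
    by (simp add: laplace_matrix_def diag_def adjacency_matrix_def matrix_vector_mult_def
        if_distrib[of complex_of_real] cong: if_cong)
  have "(\<Sum>j\<in>UNIV. complex_of_real (laplace_matrix E $ i $ j) * v $ j) =
      (\<Sum>j\<in>UNIV. ?a j) * v $ i - (\<Sum>j\<in>UNIV. ?a j * v $ j)"
    by (simp add: entry left_diff_distrib sum_subtractf if_distrib[of "\<lambda>x. x * _"] cong: if_cong)
  also have "\<dots> = (\<Sum>j\<in>UNIV. if (i, j) \<in> E then v $ i - v $ j else 0)"
    by (auto simp: sum_distrib_right sum_subtractf[symmetric] intro!: sum.cong)
  also have "\<dots> = (\<Sum>j | (i, j) \<in> E. v $ i - v $ j)"
    by (simp add: sum.If_cases)
  finally show ?thesis
    by (simp add: matrix_vector_mult_def complex_laplace_nth mult.assoc sum_distrib_left[symmetric]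
        del: nth_map_matrix)
qed

lemma complex_laplace_1: "complex_laplace E k *v 1 = 0"
  by (simp add: vec_eq_iff complex_laplace_mult)

lemma complex_eigenvalue_iff: "complex_eigenvalue M z \<longleftrightarrow> det (mat z - map_matrix complex_of_real M) = 0"
proof -
  have "mat z *v v = z *s v" for v :: "complex ^ 'a"
    by (simp add: vec_eq_iff matrix_vector_mult_def mat_def if_distrib[of "\<lambda>x. x * _"] cong: if_cong)
  then show ?thesis
    unfolding complex_eigenvalue_def det_eq_0_iff_kernel
    by (auto simp: matrix_vector_mult_diff_rdistrib)
qed

text \<open>A Gershgorin estimate in the row of an entry of \<open>v\<close> of maximal modulus.\<close>
lemma eigenvalue_disc:
  fixes k :: "real ^ 'N::finite"
  assumes k: "\<And>i. k $ i > 0"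
    and ev: "complex_eigenvalue (diag k ** laplace_matrix E) z"
  obtains i where "norm (z - complex_of_real (k $ i * card {j. (i, j) \<in> E}))
    \<le> k $ i * card {j. (i, j) \<in> E}"
proof -
  from ev obtain v where v: "v \<noteq> 0" "complex_laplace E k *v v = z *s v"
    unfolding complex_eigenvalue_def by blast
  have "Max (range (\<lambda>i. norm (v $ i))) \<in> range (\<lambda>i. norm (v $ i))"
    by (intro Max_in) auto
  then obtain i where i: "norm (v $ i) = Max (range (\<lambda>i. norm (v $ i)))"
    by (metis imageE)
  then have max: "norm (v $ j) \<le> norm (v $ i)" for j
    by simp
  have pos: "norm (v $ i) > 0"
    using v(1) max by (metis less_le_trans vec_eq_iff zero_index zero_less_norm_iff)
  let ?S = "{j. (i, j) \<in> E}"
  have "z * v $ i = complex_of_real (k $ i) * (\<Sum>j\<in>?S. v $ i - v $ j)"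
    using complex_laplace_mult[of k E v i] v(2) by simp
  then have *: "(z - complex_of_real (k $ i * card ?S)) * v $ i = 
      - (complex_of_real (k $ i) * (\<Sum>j\<in>?S. v $ j))"
    by (simp add: sum_subtractf algebra_simps)
  have "norm (z - complex_of_real (k $ i * card ?S)) * norm (v $ i) = k $ i * norm (\<Sum>j\<in>?S. v $ j)"
    using arg_cong[OF *, of norm] by (simp only: norm_mult norm_minus_cancel norm_of_real abs_of_pos[OF k])
  also have "\<dots> \<le> k $ i * (card ?S * norm (v $ i))"
    using k[of i] max by (intro mult_left_mono sum_norm_bound) auto
  finally have "norm (z - complex_of_real (k $ i * card ?S)) \<le> k $ i * card ?S"
    using pos by (simp add: mult.assoc[symmetric])
  then show ?thesis by (rule that)
qed

text \<open>Each Gershgorin disc has a real centre equal to its radius, so it meets the closed left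
  half-plane only at \<open>0\<close>.\<close>

lemma eigenvalue_Re_pos:
  fixes k :: "real ^ 'N::finite"
  assumes "\<And>i. k $ i > 0" "complex_eigenvalue (diag k ** laplace_matrix E) z" "z \<noteq> 0"
  shows "Re z > 0"
proof -
  obtain i where "norm (z - complex_of_real (k $ i * card {j. (i, j) \<in> E}))
    \<le> k $ i * card {j. (i, j) \<in> E}" (is "norm (z - of_real ?r) \<le> ?r")
    using eigenvalue_disc[OF assms(1,2)] .
  moreover from this have r: "0 \<le> ?r" by (rule order_trans[OF norm_ge_zero])
  ultimately have "(norm (z - of_real ?r))\<^sup>2 \<le> ?r\<^sup>2"
    by (intro power_mono) auto
  then have *: "(Re z)\<^sup>2 + (Im z)\<^sup>2 \<le> 2 * ?r * Re z"
    unfolding cmod_power2 by (simp add: power2_diff algebra_simps)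
  have "(Re z)\<^sup>2 + (Im z)\<^sup>2 > 0"
    using \<open>z \<noteq> 0\<close> by (simp add: sum_power2_gt_zero_iff complex_eq_iff)
  with * have "2 * ?r * Re z > 0" by linarith
  with r show ?thesis by (simp add: zero_less_mult_iff)
qed

lemma eigenvalue_norm_le:
  fixes k :: "real ^ 'N::finite"
  assumes "\<And>i. k $ i > 0" "\<And>i. k $ i \<le> 1" "complex_eigenvalue (diag k ** laplace_matrix E) z"
  shows "norm z \<le> 2 * CARD('N)"
proof -
  obtain i where "norm (z - complex_of_real (k $ i * card {j. (i, j) \<in> E}))
    \<le> k $ i * card {j. (i, j) \<in> E}" (is "norm (z - of_real ?r) \<le> ?r")
    using eigenvalue_disc[OF assms(1,3)] .
  moreover from this have "0 \<le> ?r" by (rule order_trans[OF norm_ge_zero])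
  moreover have "?r \<le> 1 * real CARD('N)"
    using assms(1,2)[of i] by (intro mult_mono) (auto intro: card_mono less_imp_le)
  ultimately show ?thesis
    using norm_triangle_sub[of z "of_real ?r"] norm_of_real[of ?r, where 'a = complex]
    by linarith
qed

section \<open>Maximum principle along the spanning tree\<close>

text \<open>At a maximiser all differences are nonnegative, so a nonpositive sum makes every parent
  a maximiser too; a path to the root carries the maximum there.\<close>

lemma root_value_max:
  fixes x :: "'N::finite \<Rightarrow> real"
  assumes reach: "\<And>v. (v, \<rho>) \<in> E\<^sup>*"
    and x: "\<And>i. (\<Sum>j | (i, j) \<in> E. x i - x j) \<le> 0"
  shows "x i \<le> x \<rho>"
proof -
  define m where "m = Max (range x)"
  have le: "x j \<le> m" for j by (simp add: m_def)
  have "m \<in> range x" unfolding m_def by (intro Max_in) auto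
  then obtain a where a: "x a = m" by auto
  have step: "x j = m" if "x i = m" "(i, j) \<in> E" for i j
  proof -
    have "(\<Sum>j | (i, j) \<in> E. x i - x j) = 0"
      using x[of i] le that(1) by (intro antisym sum_nonneg) auto
    then have "\<forall>j\<in>{j. (i, j) \<in> E}. x i - x j = 0"
      using le that(1) by (subst (asm) sum_nonneg_eq_0_iff) auto
    then show ?thesis using that by auto
  qed
  have "x \<rho> = m"
    using reach[of a] by (induction rule: rtrancl_induct) (use a step in auto)
  then show ?thesis using le by simp
qed

text \<open>The sum is nonnegative at a maximiser and nonpositive at a minimiser, hence
  \<open>c = 0\<close>; then the maximum principle applies to both \<open>x\<close> and
  \<open>- x\<close>.\<close>

lemma weighted_laplacian_constant:
  fixes x :: "'N::finite \<Rightarrow> real"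
  assumes reach: "\<And>v. (v, \<rho>) \<in> E\<^sup>*" and k: "\<And>i. k i > 0"
    and x: "\<And>i. k i * (\<Sum>j | (i, j) \<in> E. x i - x j) = c"
  shows "c = 0" and "x i = x \<rho>"
proof -
  have "Max (range x) \<in> range x" "Min (range x) \<in> range x"
    by (intro Max_in Min_in; simp)+
  then obtain a b where ab: "Max (range x) = x a" "Min (range x) = x b" by blast
  have ab': "x j \<le> x a" "x b \<le> x j" for j
    by (simp_all add: ab[symmetric])
  have "0 \<le> k a * (\<Sum>j | (a, j) \<in> E. x a - x j)"
    using k[of a] ab' by (auto intro!: mult_nonneg_nonneg sum_nonneg)
  moreover have "k b * (\<Sum>j | (b, j) \<in> E. x b - x j) \<le> 0"
    using k[of b] ab' by (auto intro!: mult_nonneg_nonpos sum_nonpos)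
  ultimately show c: "c = 0" using x by simp
  have "(\<Sum>j | (i, j) \<in> E. x i - x j) = 0" for i
    using x[of i] k[of i] c by simp
  moreover have "(\<Sum>j | (i, j) \<in> E. - x i - - x j) = - (\<Sum>j | (i, j) \<in> E. x i - x j)" for i
    by (simp add: sum_negf[symmetric])
  ultimately have "x i \<le> x \<rho>" "- x i \<le> - x \<rho>"
    using root_value_max[OF reach, of x] root_value_max[OF reach, of "\<lambda>j. - x j"] by simp_all
  then show "x i = x \<rho>" by simp
qed

text \<open>The weights are real, so real and imaginary parts can be treated separately.\<close>

lemma complex_laplace_constant:
  fixes k :: "real ^ 'N::finite" and v :: "complex ^ 'N"
  assumes reach: "\<And>u. (u, \<rho>) \<in> E\<^sup>*" and k: "\<And>i. k $ i > 0"
    and v: "complex_laplace E k *v v = vec c"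
  shows "c = 0" and "v $ i = v $ \<rho>"
proof -
  have *: "complex_of_real (k $ i) * (\<Sum>j | (i, j) \<in> E. v $ i - v $ j) = c" for i
    using complex_laplace_mult[of k E v i] v by simp
  have re: "k $ i * (\<Sum>j | (i, j) \<in> E. Re (v $ i) - Re (v $ j)) = Re c" for i
    using arg_cong[OF *[of i], of Re] by simp
  have im: "k $ i * (\<Sum>j | (i, j) \<in> E. Im (v $ i) - Im (v $ j)) = Im c" for i
    using arg_cong[OF *[of i], of Im] by simp
  show "c = 0" "v $ i = v $ \<rho>"
    using weighted_laplacian_constant[OF reach k re]
      weighted_laplacian_constant[OF reach k im]
    by (auto simp: complex_eq_iff)
qed

text \<open>A kernel vector at \<open>0\<close> would make a multiple of the all-ones vector the image of a vector
  vanishing at \<open>m\<close>; the multiple is \<open>0\<close>, and the vector, being constant, is \<open>0\<close> as well.\<close>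
lemma reduced_char_poly_0_neq_0:
  fixes k :: "real ^ 'N::finite"
  assumes reach: "\<And>u. (u, \<rho>) \<in> E\<^sup>*" and k: "\<And>i. k $ i > 0"
  shows "poly (reduced_char_poly m (complex_laplace E k)) 0 \<noteq> 0"
proof
  let ?M = "complex_laplace E k"
  assume "poly (reduced_char_poly m ?M) 0 = 0"
  then obtain y where y: "y \<noteq> 0" "ones_column m (mat 0 - ?M) *v y = 0"
    unfolding poly_reduced_char_poly det_eq_0_iff_kernel by blast
  define v where "v = (\<chi> i. if i = m then 0 else y $ i)"
  \<comment> \<open>The column of ones contributes \<open>y $ m\<close> to every row; the other
    columns are those of \<open>- ?M\<close>, and \<open>v\<close> vanishes at
    \<open>m\<close>.\<close>
  have "(ones_column m (mat 0 - ?M) *v y) $ i = y $ m - (?M *v v) $ i" for i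
  proof -
    have "(ones_column m (mat 0 - ?M) *v y) $ i =
        (\<Sum>j\<in>UNIV. (if j = m then y $ m else 0) - ?M $ i $ j * v $ j)"
      unfolding matrix_vector_mult_def
      by (auto simp: ones_column_def v_def mat_def intro!: sum.cong)
    then show ?thesis
      by (simp add: sum_subtractf matrix_vector_mult_def)
  qed
  then have "?M *v v = vec (y $ m)"
    using y(2) by (simp add: vec_eq_iff)
  note c = complex_laplace_constant[OF reach k this]
  have "v $ i = 0" for i
    using c(2)[of i] c(2)[of m] by (simp add: v_def)
  then have "y = 0"
    using c(1) by (simp add: vec_eq_iff v_def) metis
  with y(1) show False by simp
qed

section \<open>Least real part of the nonzero eigenvalues\<close>

lemma nonzero_eigenvalue_iff:
  fixes k :: "real ^ 'N::finite"
  assumes "\<And>u. (u, \<rho>) \<in> E\<^sup>*" and "\<And>i. k $ i > 0"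
  shows "complex_eigenvalue (diag k ** laplace_matrix E) z \<and> z \<noteq> 0 \<longleftrightarrow>
    poly (reduced_char_poly m (complex_laplace E k)) z = 0"
  using reduced_char_poly_0_neq_0[OF assms, of m]
  by (auto simp: complex_eigenvalue_iff det_eq_mult_reduced_char_poly[OF complex_laplace_1, of _ _ _ m])

lemma min_re_eigenvalue_eq:
  fixes k :: "real ^ 'N::finite"
  assumes "\<And>u. (u, \<rho>) \<in> E\<^sup>*" and "\<And>i. k $ i > 0"
  shows "min_re_eigenvalue (diag k ** laplace_matrix E) =
    min_re_root (reduced_char_poly m (complex_laplace E k))"
  unfolding min_re_eigenvalue_def min_re_root_def nonzero_eigenvalue_iff[OF assms, of _ m] ..

lemma degree_reduced_char_poly_pos:
  fixes E :: "('N::finite \<times> 'N) set"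
  assumes "CARD('N) \<ge> 2"
  shows "degree (reduced_char_poly m (complex_laplace E k)) > 0"
  using assms by (simp add: monic_reduced_char_poly(1)[OF complex_laplace_1])

text \<open>With at least two vertices the reduced polynomial is nonconstant, so the minimum is
  attained at a nonzero eigenvalue.\<close>

lemma min_re_eigenvalue_pos:
  fixes k :: "real ^ 'N::finite"
  assumes N: "CARD('N) \<ge> 2"
    and reach: "\<And>u. (u, \<rho>) \<in> E\<^sup>*" and k: "\<And>i. k $ i > 0"
  shows "min_re_eigenvalue (diag k ** laplace_matrix E) > 0"
proof -
  \<comment> \<open>Any vertex can serve as the column index; \<open>undefined\<close> is an
    arbitrary one.\<close>
  obtain z where "poly (reduced_char_poly undefined (complex_laplace E k)) z = 0"
    "min_re_root (reduced_char_poly undefined (complex_laplace E k)) = Re z"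
    using min_re_root_attained[OF degree_reduced_char_poly_pos[OF N]] .
  then show ?thesis
    using eigenvalue_Re_pos[OF k] nonzero_eigenvalue_iff[OF reach k]
      min_re_eigenvalue_eq[OF reach k] by metis
qed

lemma continuous_on_min_re_eigenvalue:
  fixes S :: "(real ^ 'N::finite) set"
  assumes N: "CARD('N) \<ge> 2"
    and reach: "\<And>u. (u, \<rho>) \<in> E\<^sup>*" and S: "compact S"
    and pos: "\<And>k i. k \<in> S \<Longrightarrow> k $ i > 0" and le1: "\<And>k i. k \<in> S \<Longrightarrow> k $ i \<le> 1"
  shows "continuous_on S (\<lambda>k. min_re_eigenvalue (diag k ** laplace_matrix E))"
proof -
  define Q where "Q k = reduced_char_poly undefined (complex_laplace E k)" for k
  have "continuous_on (S \<times> UNIV) (\<lambda>x. det (ones_column undefined (mat (snd x) - complex_laplace E (fst x))))"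
  proof (rule continuous_on_det)
    fix i j :: 'N
    show "continuous_on (S \<times> UNIV)
      (\<lambda>x. ones_column undefined (mat (snd x) - complex_laplace E (fst x)) $ i $ j)"
      by (cases "j = undefined"; cases "i = j")
        (auto simp: ones_column_def mat_def complex_laplace_nth simp del: nth_map_matrix
          intro!: continuous_intros)
  qed
  then have cont: "continuous_on (S \<times> UNIV) (\<lambda>(k, z). poly (Q k) z)"
    by (simp add: Q_def poly_reduced_char_poly case_prod_unfold)
  have "continuous_on S (\<lambda>k. min_re_root (Q k))"
  proof (rule continuous_on_min_re_root[OF S cont])
    show "lead_coeff (Q k) = 1" for k
      unfolding Q_def by (rule monic_reduced_char_poly(2)[OF complex_laplace_1])
    show "degree (Q k) = CARD('N) - 1" for k
      unfolding Q_def by (rule monic_reduced_char_poly(1)[OF complex_laplace_1])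
    \<comment> \<open>Weights of at most \<open>1\<close> bound all Gershgorin discs, hence the
      roots, uniformly over \<open>S\<close>.\<close>
    show "norm z \<le> real (2 * CARD('N))" if "k \<in> S" "poly (Q k) z = 0" for k z
      using that(2) nonzero_eigenvalue_iff[OF reach pos[OF that(1)]]
        eigenvalue_norm_le[OF pos[OF that(1)] le1[OF that(1)]]
      unfolding Q_def by metis
  qed (use N in auto)
  moreover have "min_re_eigenvalue (diag k ** laplace_matrix E) = min_re_root (Q k)" if "k \<in> S" for k
    unfolding Q_def by (rule min_re_eigenvalue_eq[OF reach pos[OF that]])
  ultimately show ?thesis by (simp cong: continuous_on_cong)
qed

section \<open>The sets \<open>S_eps\<close> and \<open>K_r\<close>\<close>

lemma compact_S_eps: "compact (S_eps \<epsilon> :: (real ^ 'N::finite) set)"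
proof -
  have "S_eps \<epsilon> = sphere 0 1 \<inter> (\<Inter>i. {k :: real ^ 'N. \<epsilon> \<le> k $ i})"
    by (auto simp: S_eps_def)
  moreover have "closed (\<Inter>i. {k :: real ^ 'N. \<epsilon> \<le> k $ i})"
    by (intro closed_INT ballI closed_Collect_le continuous_intros)
  ultimately show ?thesis
    by (simp add: compact_Int_closed)
qed

lemma S_eps_nonempty:
  assumes "\<epsilon> \<le> 1 / sqrt (real CARD('N))"
  shows "S_eps \<epsilon> \<noteq> ({} :: (real ^ 'N::finite) set)"
proof -
  \<comment> \<open>The constant unit vector is the witness; on the sphere no vector has a larger
    least coordinate.\<close>
  have "norm (vec (1 / sqrt (real CARD('N))) :: real ^ 'N) = 1"
    by (simp add: norm_vec_def L2_set_def power_divide)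
  then show ?thesis
    using assms by (auto simp: S_eps_def intro!: exI[of _ "vec (1 / sqrt (real CARD('N)))"])
qed

text \<open>The ray through \<open>k'\<close> meets \<open>K_r \<kappa> L\<close> exactly beyond the scaling factor \<open>c\<close>.\<close>
lemma scaled_in_frontier_K_r:
  fixes k' :: "real ^ 'N::finite"
  assumes pos: "\<And>i. k' $ i > 0" and norm: "norm k' = 1"
    and c: "c = \<kappa> / min_re_eigenvalue (diag k' ** L)" "c > 0"
  shows "c *\<^sub>R k' \<in> frontier (K_r \<kappa> L)"
proof -
  have "c *\<^sub>R k' \<notin> K_r \<kappa> L"
  proof
    assume "c *\<^sub>R k' \<in> K_r \<kappa> L"
    then obtain d u where u: "c *\<^sub>R k' = d *\<^sub>R u" "norm u = 1" "d > 0"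
      "d > \<kappa> / min_re_eigenvalue (diag u ** L)"
      unfolding K_r_def by auto
    \<comment> \<open>Both \<open>u\<close> and \<open>k'\<close> are unit vectors, so taking norms
      recovers the scaling factor.\<close>
    have "d = c"
      using arg_cong[OF u(1), of norm] u(2,3) norm c(2) by simp
    then have "u = k'" using u(1) c(2) by simp
    with \<open>d = c\<close> u(4) c(1) show False by simp
  qed
  moreover have "(c + t) *\<^sub>R k' \<in> K_r \<kappa> L" if "t > 0" for t
    unfolding K_r_def positive_orthant_def mem_Collect_eq
    using that c pos norm
    by (intro conjI exI[of _ "c + t"] exI[of _ k']) auto
  \<comment> \<open>These points tend to \<open>c *\<^sub>R k'\<close>, which therefore lies in the
    closure of \<open>K_r \<kappa> L\<close> but not in the set itself.\<close>
  then have "\<forall>n. (c + 1 / real (Suc n)) *\<^sub>R k' \<in> K_r \<kappa> L"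
    by simp
  moreover have "(\<lambda>n. (c + 1 / real (Suc n)) *\<^sub>R k') \<longlonglongrightarrow> (c + 0) *\<^sub>R k'"
    by (intro tendsto_intros LIMSEQ_Suc[OF lim_1_over_n])
  ultimately have "c *\<^sub>R k' \<in> closure (K_r \<kappa> L)"
    unfolding closure_sequential add_0_right
    by (intro exI[of _ "\<lambda>n. (c + 1 / real (Suc n)) *\<^sub>R k'"] conjI)
  with \<open>c *\<^sub>R k' \<notin> K_r \<kappa> L\<close> show ?thesis
    using interior_subset unfolding frontier_def by blast
qed

theorem lemma3:
  fixes A :: "real ^ 'n ^ 'n" and B :: "real ^ 1 ^ 'n" and C :: "real ^ 'l ^ 'n"
    and g :: "real ^ 'l" and E :: "('N::finite \<times> 'N) set" and L :: "real ^ 'N ^ 'N"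
    and \<kappa> \<epsilon> :: real and h :: "real ^ 'N \<Rightarrow> real ^ 'N" and h\<^sub>\<rho> :: "real ^ 'N \<Rightarrow> real"
  assumes "CARD('N) \<ge> 2"
    and "hyper_minimum_phase A B C g"
    and "\<kappa> = kappa0 A B C g" and "\<kappa> > 0"
    and "no_self_loops E" and "\<exists>T. directed_spanning_tree E T"
    and "L = laplace_matrix E"
    and "0 < \<epsilon>" and "\<epsilon> \<le> 1 / sqrt (real CARD('N))"
    and "\<And>k'. k' \<in> S_eps \<epsilon> \<Longrightarrow> h k' = (\<kappa> / min_re_eigenvalue (diag k' ** L)) *\<^sub>R k'"
    and "\<And>k'. k' \<in> S_eps \<epsilon> \<Longrightarrow> h\<^sub>\<rho> k' = norm (h k')"
  shows "h ` S_eps \<epsilon> \<subseteq> frontier (K_r \<kappa> L) \<and>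
    continuous_on (S_eps \<epsilon>) h \<and>
    continuous_on (S_eps \<epsilon>) h\<^sub>\<rho> \<and>
    (\<exists>x\<in>S_eps \<epsilon>. \<forall>y\<in>S_eps \<epsilon>. h\<^sub>\<rho> x \<le> h\<^sub>\<rho> y) \<and>
    (\<exists>x\<in>S_eps \<epsilon>. \<forall>y\<in>S_eps \<epsilon>. h\<^sub>\<rho> y \<le> h\<^sub>\<rho> x)"
proof -
  from \<open>\<exists>T. directed_spanning_tree E T\<close> obtain T \<rho>
    where "T \<subseteq> E" "\<And>v. (v, \<rho>) \<in> T\<^sup>*"
    unfolding directed_spanning_tree_def by blast
  then have reach: "(v, \<rho>) \<in> E\<^sup>*" for v
    using rtrancl_mono by blast
  have pos: "k $ i > 0" if "k \<in> S_eps \<epsilon>" for k :: "real ^ 'N" and i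
    using that \<open>0 < \<epsilon>\<close> by (auto simp: S_eps_def intro: less_le_trans)
  have norm1: "norm k = 1" if "k \<in> S_eps \<epsilon>" for k :: "real ^ 'N"
    using that by (simp add: S_eps_def)
  have le1: "k $ i \<le> 1" if "k \<in> S_eps \<epsilon>" for k :: "real ^ 'N" and i
    using component_le_norm_cart[of k i] norm1[OF that] by simp
  let ?r = "\<lambda>k'. min_re_eigenvalue (diag k' ** L)"
  have r: "?r k' > 0" if "k' \<in> S_eps \<epsilon>" for k'
    unfolding \<open>L = laplace_matrix E\<close> using assms(1) reach pos[OF that] by (rule min_re_eigenvalue_pos)
  have frontier: "h ` S_eps \<epsilon> \<subseteq> frontier (K_r \<kappa> L)"
    using assms(10) pos norm1 r \<open>\<kappa> > 0\<close> by (auto intro!: scaled_in_frontier_K_r)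
  have "continuous_on (S_eps \<epsilon>) ?r"
    unfolding \<open>L = laplace_matrix E\<close>
    using assms(1) reach compact_S_eps pos le1 by (rule continuous_on_min_re_eigenvalue)
  then have "continuous_on (S_eps \<epsilon>) (\<lambda>k'. (\<kappa> / ?r k') *\<^sub>R k')"
    using r by (intro continuous_intros) (auto simp: less_imp_neq[THEN not_sym])
  then have h: "continuous_on (S_eps \<epsilon>) h"
    using assms(10) by (simp cong: continuous_on_cong)
  then have "continuous_on (S_eps \<epsilon>) (\<lambda>k'. norm (h k'))"
    by (rule continuous_on_norm)
  then have h\<^sub>\<rho>: "continuous_on (S_eps \<epsilon>) h\<^sub>\<rho>"
    using assms(11) by (simp cong: continuous_on_cong)
  show ?thesis
    using frontier h h\<^sub>\<rho>
      continuous_attains_inf[OF compact_S_eps S_eps_nonempty[OF assms(9)] h\<^sub>\<rho>]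
      continuous_attains_sup[OF compact_S_eps S_eps_nonempty[OF assms(9)] h\<^sub>\<rho>]
    by blast
qed

end
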